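(* Let $R$ be a commutative ring and $M$ a totally ordered cancellative (commutative) monoid, written additively. Then the following assertions hold. (i) A nonempty subset $\mathfrak p$ of $R$ is a prime ideal of $R$ if and only if $\mathfrak p[M]$ is a prime ideal of $R[M]$. In particular, $R$ is an integral domain if and only if $R[M]$ is an integral domain. (ii) The minimal primes of $R[M]$ are precisely of the form $\mathfrak p[M]$ where $\mathfrak p$ is a minimal prime of $R$. (iii) The nilradical of $R[M]$ is $\mathfrak N[M]$ where $\mathfrak N$ is the nilradical of $R$. (iv) $R$ is reduced if and only if $R[M]$ is reduced. (v) $Z(R[M])\subseteq\bigcup_{\mathfrak p\in\operatorname{Spec}(R)}\mathfrak p[M]$. (vi) If $R$ is a zero-dimensional ring, then $Z(R[M])=\bigcup_{\mathfrak p\in\operatorname{Spec}(R)}\mathfrak p[M]$. (vii) For $f=\sum_{x\in M}r_x\epsilon_x$ and $g=\sum_{y\in M}r'_y\epsilon_y$ in $R[M]$, $fg$ is nilpotent if and only if $r_xr'_y$ is nilpotent for all $x,y\in M$. (viii) An ideal $I$ of $R$ is faithful if and only if $I[M]$ is a faithful ideal of $R[M]$.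
   Context: Rings have an identity. $R[M]$ is the monoid-ring: the free $R$-module with basis $\{\epsilon_m: m\in M\}$ and multiplication determined $R$-bilinearly by $\epsilon_m\epsilon_n=\epsilon_{m+n}$. For a nonempty subset $I\subseteq R$, $I[M]$ is the set of all $\sum_{m\in M}r_m\epsilon_m\in R[M]$ with $r_m\in I$ for all $m\in M$. A totally ordered monoid is a commutative monoid with a total order $<$ such that $a<b$ implies $a+x\leqslant b+x$ for all $x$; cancellative means $a+x=b+x$ implies $a=b$. $Z(S)$ is the set of zero-divisors of a ring $S$, i.e. elements $f$ with $fg=0$ for some nonzero $g\in S$. An ideal is faithful if its annihilator is zero. *)

theory Defs
  imports "HOL-Algebra.Algebra" "HOL-Library.Extended_Nat"
begin

(* Monoids are multiplicative records in HOL-Algebra, so the sum of m and n in M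
   appears as m \<otimes>\<^bsub>M\<^esub> n.  The relation lt is the strict order. *)
locale totally_ordered_monoid = comm_monoid M for M (structure) +
  fixes lt :: "('a \<times> 'a) set"
  assumes strict_total_order: "strict_linear_order_on (carrier M) lt"
    and translate: "\<lbrakk>a \<in> carrier M; b \<in> carrier M; x \<in> carrier M; (a, b) \<in> lt\<rbrakk>
      \<Longrightarrow> (a \<otimes> x, b \<otimes> x) \<in> lt\<^sup>="

(* An element \<Sum>m\<in>M. r\<^sub>m \<epsilon>\<^sub>m of R[M] is represented by its coefficient function m \<mapsto> r\<^sub>m,
   which vanishes outside a finite subset of carrier M. *)
definition monoid_ring_carrier ::
    "('a, 'b) ring_scheme \<Rightarrow> ('m, 'c) monoid_scheme \<Rightarrow> ('m \<Rightarrow> 'a) set" where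
  "monoid_ring_carrier R M =
     {f. (\<forall>m. f m \<in> carrier R) \<and> (\<forall>m. m \<notin> carrier M \<longrightarrow> f m = \<zero>\<^bsub>R\<^esub>) \<and>
         finite {m. f m \<noteq> \<zero>\<^bsub>R\<^esub>}}"

(* The bilinear extension of \<epsilon>\<^sub>m \<epsilon>\<^sub>n = \<epsilon>\<^sub>m\<^sub>+\<^sub>n.  The sum is restricted to the supports because
   finsum is only meaningful over finite index sets. *)
definition monoid_ring_mult ::
    "('a, 'b) ring_scheme \<Rightarrow> ('m, 'c) monoid_scheme \<Rightarrow> ('m \<Rightarrow> 'a) \<Rightarrow> ('m \<Rightarrow> 'a) \<Rightarrow> 'm \<Rightarrow> 'a" where
  "monoid_ring_mult R M f g = (\<lambda>m.
     \<Oplus>\<^bsub>R\<^esub>p \<in> {(x, y). f x \<noteq> \<zero>\<^bsub>R\<^esub> \<and> g y \<noteq> \<zero>\<^bsub>R\<^esub> \<and> x \<otimes>\<^bsub>M\<^esub> y = m}. f (fst p) \<otimes>\<^bsub>R\<^esub> g (snd p))"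

definition monoid_ring ::
    "('a, 'b) ring_scheme \<Rightarrow> ('m, 'c) monoid_scheme \<Rightarrow> ('m \<Rightarrow> 'a) ring" where
  "monoid_ring R M =
     \<lparr>carrier = monoid_ring_carrier R M,
      monoid.mult = monoid_ring_mult R M,
      one = (\<lambda>m. if m = \<one>\<^bsub>M\<^esub> then \<one>\<^bsub>R\<^esub> else \<zero>\<^bsub>R\<^esub>),
      ring.zero = (\<lambda>m. \<zero>\<^bsub>R\<^esub>),
      ring.add = (\<lambda>f g m. f m \<oplus>\<^bsub>R\<^esub> g m)\<rparr>"

(* The set I[M]. *)
definition coeffs_in ::
    "('a, 'b) ring_scheme \<Rightarrow> ('m, 'c) monoid_scheme \<Rightarrow> 'a set \<Rightarrow> ('m \<Rightarrow> 'a) set" where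
  "coeffs_in R M I = {f \<in> carrier (monoid_ring R M). \<forall>m \<in> carrier M. f m \<in> I}"

definition prime_spec :: "('a, 'b) ring_scheme \<Rightarrow> 'a set set" where
  "prime_spec R = {P. primeideal P R}"

definition minimal_prime :: "('a, 'b) ring_scheme \<Rightarrow> 'a set \<Rightarrow> bool" where
  "minimal_prime R P \<longleftrightarrow> P \<in> prime_spec R \<and> (\<forall>Q \<in> prime_spec R. Q \<subseteq> P \<longrightarrow> Q = P)"

definition nilpotent :: "('a, 'b) ring_scheme \<Rightarrow> 'a \<Rightarrow> bool" where
  "nilpotent R x \<longleftrightarrow> x \<in> carrier R \<and> (\<exists>n::nat. n > 0 \<and> x [^]\<^bsub>R\<^esub> n = \<zero>\<^bsub>R\<^esub>)"

definition nilradical :: "('a, 'b) ring_scheme \<Rightarrow> 'a set" where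
  "nilradical R = {x. nilpotent R x}"

definition reduced_ring :: "('a, 'b) ring_scheme \<Rightarrow> bool" where
  "reduced_ring R \<longleftrightarrow> (\<forall>x. nilpotent R x \<longrightarrow> x = \<zero>\<^bsub>R\<^esub>)"

(* 0 is a zero-divisor of every nonzero ring. *)
definition zero_divisors :: "('a, 'b) ring_scheme \<Rightarrow> 'a set" where
  "zero_divisors R =
     {f \<in> carrier R. \<exists>g \<in> carrier R. g \<noteq> \<zero>\<^bsub>R\<^esub> \<and> f \<otimes>\<^bsub>R\<^esub> g = \<zero>\<^bsub>R\<^esub>}"

(* The Krull dimension: the supremum of the lengths n of chains P 0 \<subset> \<dots> \<subset> P n of primes.
   The supremum of the empty set is 0 in enat, so the zero ring has dimension 0 here. *)
definition krull_dim :: "('a, 'b) ring_scheme \<Rightarrow> enat" where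
  "krull_dim R = Sup {enat n | n. \<exists>P :: nat \<Rightarrow> 'a set.
     (\<forall>i \<le> n. P i \<in> prime_spec R) \<and> (\<forall>i < n. P i \<subset> P (Suc i))}"

definition annihilator :: "('a, 'b) ring_scheme \<Rightarrow> 'a set \<Rightarrow> 'a set" where
  "annihilator R I = {r \<in> carrier R. \<forall>a \<in> I. r \<otimes>\<^bsub>R\<^esub> a = \<zero>\<^bsub>R\<^esub>}"

definition faithful_ideal :: "('a, 'b) ring_scheme \<Rightarrow> 'a set \<Rightarrow> bool" where
  "faithful_ideal R I \<longleftrightarrow> ideal I R \<and> annihilator R I = {\<zero>\<^bsub>R\<^esub>}"

end

(*
  A prime P of R extends to P[M]: if f, g lie outside P[M], let x and y be the largest
  exponents at which their coefficients leave P.  By strict monotonicity of addition, every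
  other decomposition x' + y' = x + y has x' > x or y' > y, so the coefficient of fg at x + y
  is f x * g y modulo P.  A prime Q of R[M] contracts to R along the constants, and the
  extension of its contraction lies in Q; hence membership in all primes, and minimality,
  can be tested on the primes P[M].  The same leading coefficient argument modulo the zero
  ideal gives McCoy's theorem, that a zero-divisor f is killed by a nonzero constant r; the
  coefficients of f then lie in any prime containing the annihilator of r.  If R is
  zero-dimensional, every prime P is minimal, so each coefficient in P is nilpotent in the
  localization at P, and finitely many of them have a common nonzero annihilator.
*)
theory Submission
  imports Defs
begin

section \<open>Prime ideals avoiding multiplicative sets\<close>

text \<open>An ideal \<open>P\<close> maximal among those containing \<open>I\<close> and missing
  \<open>S\<close> is prime: for \<open>a\<close> and \<open>b\<close> outside \<open>P\<close>,
  both \<open>P + (a)\<close> and \<open>P + (b)\<close> meet \<open>S\<close>. The product of two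
  such elements of \<open>S\<close> lies in \<open>P + (ab)\<close>, so
  \<open>a \<otimes> b \<in> P\<close> would make \<open>P\<close> meet \<open>S\<close>.\<close>

lemma (in cring) exists_prime_disjoint:
  assumes I: "ideal I R" and S: "S \<subseteq> carrier R" "\<one> \<in> S"
    and mult: "\<And>s t. s \<in> S \<Longrightarrow> t \<in> S \<Longrightarrow> s \<otimes> t \<in> S" and disj: "I \<inter> S = {}"
  shows "\<exists>P. primeideal P R \<and> I \<subseteq> P \<and> P \<inter> S = {}"
proof -
  define A where "A = {J. ideal J R \<and> I \<subseteq> J \<and> J \<inter> S = {}}"
  have "\<exists>P\<in>A. \<forall>J\<in>A. P \<subseteq> J \<longrightarrow> J = P"
  proof (rule subset_Zorn_nonempty)
    show "A \<noteq> {}" using I disj by (auto simp: A_def)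
    fix C assume ne: "C \<noteq> {}" and C: "subset.chain A C"
    have "subset.chain {J. ideal J R} C"
      using C by (auto simp: A_def pred_on.chain_def)
    then have "ideal (\<Union>C) R" using chain_Union_is_ideal[of C] ne by simp
    moreover have "I \<subseteq> \<Union>C" "\<Union>C \<inter> S = {}"
      using C ne unfolding A_def pred_on.chain_def by blast+
    ultimately show "\<Union>C \<in> A" by (simp add: A_def)
  qed
  then obtain P where P: "ideal P R" "I \<subseteq> P" "P \<inter> S = {}"
    and max: "\<And>J. ideal J R \<Longrightarrow> P \<subseteq> J \<Longrightarrow> J \<inter> S = {} \<Longrightarrow> J = P"
    by (force simp: A_def)
  interpret P: ideal P R by fact
  have meets: "\<exists>p\<in>P. \<exists>r\<in>carrier R. p \<oplus> r \<otimes> a \<in> S" if a: "a \<in> carrier R" "a \<notin> P" for a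
  proof -
    define J where "J = set_add R P (PIdl a)"
    have J: "ideal J R" unfolding J_def by (intro add_ideals P cgenideal_ideal a)
    have eqJ: "J = {p \<oplus> r \<otimes> a |p r. p \<in> P \<and> r \<in> carrier R}"
      by (auto simp: J_def set_add_def set_mult_def cgenideal_def; blast)
    have "P \<subseteq> J"
    proof
      fix p assume "p \<in> P"
      then have "p = p \<oplus> \<zero> \<otimes> a" using a by simp
      then show "p \<in> J" unfolding eqJ using \<open>p \<in> P\<close> by blast
    qed
    moreover have "a \<in> J"
    proof -
      have "a = \<zero> \<oplus> \<one> \<otimes> a" using a by simp
      then show ?thesis unfolding eqJ using P.zero_closed by blast
    qed
    ultimately have "J \<inter> S \<noteq> {}" using max[OF J] a by blast
    then show ?thesis unfolding eqJ by blast
  qed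
  have "primeideal P R"
  proof (rule primeidealI[OF P(1) is_cring])
    show "carrier R \<noteq> P" using P(3) S by blast
    fix a b assume ab: "a \<in> carrier R" "b \<in> carrier R" "a \<otimes> b \<in> P"
    show "a \<in> P \<or> b \<in> P"
    proof (rule ccontr)
      assume "\<not> (a \<in> P \<or> b \<in> P)"
      then have "a \<notin> P" "b \<notin> P" by auto
      then obtain p r q t where pr: "p \<in> P" "r \<in> carrier R" "p \<oplus> r \<otimes> a \<in> S"
        and qt: "q \<in> P" "t \<in> carrier R" "q \<oplus> t \<otimes> b \<in> S"
        using meets[OF ab(1)] meets[OF ab(2)] by metis
      have pq: "p \<in> carrier R" "q \<in> carrier R" using pr qt P.a_subset by auto
      have "(p \<oplus> r \<otimes> a) \<otimes> (q \<oplus> t \<otimes> b) = (q \<oplus> t \<otimes> b) \<otimes> p \<oplus> ((r \<otimes> a) \<otimes> q \<oplus> (r \<otimes> t) \<otimes> (a \<otimes> b))"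
        using pq pr qt ab by algebra
      also have "\<dots> \<in> P"
        using pq pr qt ab
        by (intro P.a_closed P.I_l_closed[OF pr(1)] P.I_l_closed[OF qt(1)] P.I_l_closed[OF ab(3)]) auto
      finally show False using mult[OF pr(3) qt(3)] P(3) by blast
    qed
  qed
  with P show ?thesis by blast
qed

text \<open>If \<open>a\<close> is not nilpotent, its powers form a multiplicative set missing zero,
  and some prime avoids all of them. Later statements about nilpotents are reduced to statements
  about one prime at a time through this criterion.\<close>

lemma (in cring) nilpotent_iff_primes:
  assumes a: "a \<in> carrier R"
  shows "nilpotent R a \<longleftrightarrow> (\<forall>P. primeideal P R \<longrightarrow> a \<in> P)"
proof
  assume "nilpotent R a"
  then obtain n :: nat where n: "a [^] n = \<zero>" by (auto simp: nilpotent_def)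
  show "\<forall>P. primeideal P R \<longrightarrow> a \<in> P"
  proof (intro allI impI)
    fix P assume "primeideal P R"
    then interpret P: primeideal P R .
    have "a [^] k \<in> P \<Longrightarrow> a \<in> P" for k :: nat
    proof (induction k)
      case 0
      then show ?case using P.one_imp_carrier P.I_notcarr by simp
    next
      case (Suc k)
      then show ?case using a P.I_prime[of "a [^] k" a] by auto
    qed
    then show "a \<in> P" using n P.zero_closed by metis
  qed
next
  assume *: "\<forall>P. primeideal P R \<longrightarrow> a \<in> P"
  show "nilpotent R a"
  proof (rule ccontr)
    assume nil: "\<not> nilpotent R a"
    have pos: "a [^] n \<noteq> \<zero>" if "n > 0" for n :: nat
      using nil a that unfolding nilpotent_def by blast
    \<comment> \<open>\<open>nilpotent\<close> asks for a positive exponent; the exponent zero is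
      covered by passing to the next power.\<close>
    have "a [^] n \<noteq> \<zero>" for n :: nat
    proof
      assume "a [^] n = \<zero>"
      then have "a [^] Suc n = \<zero>" using a by simp
      then show False using pos[of "Suc n"] by simp
    qed
    then have "{\<zero>} \<inter> range (\<lambda>n::nat. a [^] n) = {}" by force
    moreover have "\<one> \<in> range (\<lambda>n::nat. a [^] n)" by (metis nat_pow_0 rangeI)
    moreover have "s \<otimes> t \<in> range (\<lambda>n::nat. a [^] n)"
      if "s \<in> range (\<lambda>n::nat. a [^] n)" "t \<in> range (\<lambda>n::nat. a [^] n)" for s t
      using that a by (auto simp: nat_pow_mult)
    ultimately obtain P where "primeideal P R" "P \<inter> range (\<lambda>n::nat. a [^] n) = {}"
      using exists_prime_disjoint[OF zeroideal, of "range (\<lambda>n::nat. a [^] n)"] a by auto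
    moreover have "a \<in> range (\<lambda>n::nat. a [^] n)" using a by (metis nat_pow_eone rangeI)
    ultimately show False using * by blast
  qed
qed

section \<open>Minimal primes and common annihilators of finite subsets\<close>

text \<open>This expresses inside \<open>R\<close> that \<open>a\<close> becomes nilpotent in the
  localization at \<open>P\<close>; the element \<open>s\<close> is the denominator that clears the
  equation.\<close>

lemma (in cring) minimal_prime_annihilates_power:
  assumes P: "minimal_prime R P" and a: "a \<in> P"
  shows "\<exists>s\<in>carrier R - P. \<exists>n::nat. s \<otimes> a [^] n = \<zero>"
proof (rule ccontr)
  assume neg: "\<not> ?thesis"
  interpret P: primeideal P R using P by (simp add: minimal_prime_def prime_spec_def)
  have ac: "a \<in> carrier R" using a P.a_subset by auto
  \<comment> \<open>A prime avoiding \<open>S\<close> would lie inside \<open>P\<close> and omit \<open>a\<close>, contradicting minimality.\<close>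
  define S where "S = {s \<otimes> a [^] n |s n::nat. s \<in> carrier R - P}"
  have one: "\<one> \<in> carrier R - P" using P.one_imp_carrier P.I_notcarr by auto
  have S1: "s \<in> S" if "s \<in> carrier R - P" for s
  proof -
    have "s = s \<otimes> a [^] (0::nat)" using that by simp
    then show ?thesis unfolding S_def using that by blast
  qed
  have Sa: "a \<in> S"
  proof -
    have "a = \<one> \<otimes> a [^] (1::nat)" using ac by simp
    then show ?thesis unfolding S_def using one by blast
  qed
  have "\<exists>Q. primeideal Q R \<and> {\<zero>} \<subseteq> Q \<and> Q \<inter> S = {}"
  proof (rule exists_prime_disjoint[OF zeroideal])
    show "S \<subseteq> carrier R" using ac by (auto simp: S_def)
    show "\<one> \<in> S" using S1[OF one] .
    show "{\<zero>} \<inter> S = {}" using neg by (force simp: S_def)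
    fix u v assume "u \<in> S" "v \<in> S"
    then obtain s t and m n :: nat where st: "s \<in> carrier R - P" "t \<in> carrier R - P"
      and uv: "u = s \<otimes> a [^] m" "v = t \<otimes> a [^] n" unfolding S_def by blast
    have "u \<otimes> v = (s \<otimes> t) \<otimes> (a [^] m \<otimes> a [^] n)"
      using st ac unfolding uv by (simp add: m_ac)
    then have "u \<otimes> v = (s \<otimes> t) \<otimes> a [^] (m + n)" using ac by (simp add: nat_pow_mult)
    moreover have "s \<otimes> t \<in> carrier R - P" using st P.I_prime by blast
    ultimately show "u \<otimes> v \<in> S" unfolding S_def by blast
  qed
  then obtain Q where Q: "primeideal Q R" "Q \<inter> S = {}" by blast
  then have "Q \<subseteq> carrier R"
    by (simp add: additive_subgroup.a_subset ideal.axioms(1) primeideal.axioms(1))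
  then have "Q \<subseteq> P" using S1 Q by blast
  then have "Q = P" using P Q by (auto simp: minimal_prime_def prime_spec_def)
  then show False using Sa a Q by blast
qed

text \<open>Multiplying the denominators obtained for the single elements gives one
  \<open>s\<close>, still outside the prime \<open>P\<close>, that kills some power of each element
  of \<open>F\<close>. It is then enlarged to a nonzero multiple that kills the elements
  themselves.\<close>

lemma (in cring) finite_subset_minimal_prime_annihilated:
  assumes P: "minimal_prime R P" and F: "finite F" "F \<subseteq> P"
  shows "\<exists>c\<in>carrier R. c \<noteq> \<zero> \<and> (\<forall>a\<in>F. c \<otimes> a = \<zero>)"
proof -
  interpret P: primeideal P R using P by (simp add: minimal_prime_def prime_spec_def)
  have "\<exists>s\<in>carrier R - P. \<forall>a\<in>F. \<exists>n::nat. s \<otimes> a [^] n = \<zero>"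
    using F
  proof (induction F)
    case empty
    show ?case using P.one_imp_carrier P.I_notcarr by auto
  next
    case (insert b F)
    then obtain s where s: "s \<in> carrier R - P" "\<forall>a\<in>F. \<exists>n::nat. s \<otimes> a [^] n = \<zero>" by auto
    obtain t n where t: "t \<in> carrier R - P" "t \<otimes> b [^] (n::nat) = \<zero>"
      using minimal_prime_annihilates_power[OF P, of b] insert by auto
    have sub: "insert b F \<subseteq> carrier R" using insert P.a_subset by auto
    have "s \<otimes> t \<in> carrier R - P" using s t P.I_prime by blast
    moreover have "\<exists>n::nat. (s \<otimes> t) \<otimes> a [^] n = \<zero>" if a: "a \<in> insert b F" for a
    proof (cases "a = b")
      case True
      have "(s \<otimes> t) \<otimes> b [^] n = s \<otimes> (t \<otimes> b [^] n)" using s t sub by (simp add: m_assoc)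
      then show ?thesis using True s t by auto
    next
      case False
      then obtain k :: nat where k: "s \<otimes> a [^] k = \<zero>" using s a by auto
      have "(s \<otimes> t) \<otimes> a [^] k = t \<otimes> (s \<otimes> a [^] k)"
        using s t sub a by (auto simp: m_ac)
      then show ?thesis using k t by auto
    qed
    ultimately show ?case by blast
  qed
  then obtain s where s: "s \<in> carrier R - P" "\<forall>a\<in>F. \<exists>n::nat. s \<otimes> a [^] n = \<zero>" by blast
  \<comment> \<open>Multiply by the largest power of each element in turn that does not give zero.\<close>
  have "\<exists>d\<in>carrier R. s \<otimes> d \<noteq> \<zero> \<and> (\<forall>a\<in>G. (s \<otimes> d) \<otimes> a = \<zero>)" if "G \<subseteq> F" for G
    using finite_subset[OF that F(1)] that
  proof (induction G)
    case empty
    have "s \<noteq> \<zero>" using s P.zero_closed by auto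
    then show ?case using s by (intro bexI[of _ \<one>]) auto
  next
    case (insert b G)
    then obtain d where d: "d \<in> carrier R" "s \<otimes> d \<noteq> \<zero>" "\<forall>a\<in>G. (s \<otimes> d) \<otimes> a = \<zero>" by auto
    have bc: "b \<in> carrier R" and Gc: "G \<subseteq> carrier R" using insert.prems F P.a_subset by auto
    have sc: "s \<in> carrier R" using s by simp
    obtain n :: nat where n: "s \<otimes> b [^] n = \<zero>" using s insert.prems by auto
    \<comment> \<open>Only \<open>d\<close> changes during the induction. The factor
      \<open>s\<close> is kept, so a power of the next element \<open>b\<close> still kills the
      current multiple.\<close>
    have n': "(s \<otimes> d) \<otimes> b [^] n = \<zero>"
    proof -
      have "(s \<otimes> d) \<otimes> b [^] n = d \<otimes> (s \<otimes> b [^] n)" using sc d bc by (simp add: m_ac)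
      then show ?thesis using n d by simp
    qed
    define k where "k = (LEAST k. (s \<otimes> d) \<otimes> b [^] (k::nat) = \<zero>)"
    have k0: "(s \<otimes> d) \<otimes> b [^] k = \<zero>" unfolding k_def using n' by (rule LeastI)
    have "k \<noteq> 0" using k0 d sc by (intro notI) simp
    then obtain j where j: "k = Suc j" by (cases k) auto
    have "(s \<otimes> d) \<otimes> b [^] j \<noteq> \<zero>"
      using not_less_Least[of j "\<lambda>k. (s \<otimes> d) \<otimes> b [^] (k::nat) = \<zero>"] j k_def by auto
    moreover have "(s \<otimes> (d \<otimes> b [^] j)) \<otimes> b = \<zero>"
      using k0 sc d bc by (simp add: j m_assoc)
    moreover have "(s \<otimes> (d \<otimes> b [^] j)) \<otimes> a = \<zero>" if "a \<in> G" for a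
    proof -
      have ac: "a \<in> carrier R" using that Gc by auto
      have "(s \<otimes> (d \<otimes> b [^] j)) \<otimes> a = ((s \<otimes> d) \<otimes> a) \<otimes> b [^] j"
        using ac sc d bc by (simp add: m_ac)
      then show ?thesis using d that bc by simp
    qed
    ultimately show ?case using sc d bc
      by (intro bexI[of _ "d \<otimes> b [^] j"]) (auto simp: m_assoc)
  qed
  from this[of F] obtain d where "d \<in> carrier R" "s \<otimes> d \<noteq> \<zero>" "\<forall>a\<in>F. (s \<otimes> d) \<otimes> a = \<zero>" by auto
  then show ?thesis using s by (intro bexI[of _ "s \<otimes> d"]) auto
qed

text \<open>A prime strictly below \<open>P\<close> would give a chain of length 1.\<close>

lemma minimal_prime_if_krull_dim_0:
  assumes "krull_dim R = 0" and P: "primeideal P R"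
  shows "minimal_prime R P"
proof (rule ccontr)
  assume "\<not> minimal_prime R P"
  then obtain Q where Q: "primeideal Q R" "Q \<subset> P"
    using P by (auto simp: minimal_prime_def prime_spec_def)
  define C where "C = (\<lambda>i::nat. if i = 0 then Q else P)"
  have "\<forall>i\<le>1. C i \<in> prime_spec R" "\<forall>i<1. C i \<subset> C (Suc i)"
    using P Q by (auto simp: C_def prime_spec_def)
  then have "enat 1 \<le> krull_dim R"
    unfolding krull_dim_def by (intro Sup_upper) blast
  then show False using assms(1) by (simp add: zero_enat_def)
qed

lemma (in ring) finsum_in_ideal:
  assumes I: "ideal I R" and "finite F" "\<And>x. x \<in> F \<Longrightarrow> h x \<in> I"
  shows "(\<Oplus>x\<in>F. h x) \<in> I"
proof -
  interpret I: ideal I R by fact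
  have sub: "I \<subseteq> carrier R" by (rule I.a_subset)
  show ?thesis using assms(2,3)
  proof (induction F)
    case (insert x F)
    then show ?case using sub by (subst finsum_insert) (auto intro!: I.a_closed)
  qed (simp add: I.zero_closed)
qed

section \<open>The monoid ring\<close>

text \<open>This is \<open>a\<close> times the basis element at \<open>x\<close>. Taking the unit of
  \<open>M\<close> for \<open>x\<close> embeds \<open>R\<close> as the constants.\<close>

definition monomial :: "('a, 'b) ring_scheme \<Rightarrow> 'a \<Rightarrow> 'm \<Rightarrow> 'm \<Rightarrow> 'a" where
  "monomial R a x = (\<lambda>m. if m = x then a else \<zero>\<^bsub>R\<^esub>)"

locale comm_monoid_ring = R?: cring R + M: comm_monoid M
  for R :: "('a, 'b) ring_scheme" (structure) and M :: "('m, 'c) monoid_scheme" (structure)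
begin

abbreviation A :: "('m \<Rightarrow> 'a) ring" where "A \<equiv> monoid_ring R M"

abbreviation supp :: "('m \<Rightarrow> 'a) \<Rightarrow> 'm set" where "supp f \<equiv> {m. f m \<noteq> \<zero>}"

section \<open>Arithmetic of coefficient functions and the ring laws\<close>

lemma zero_A: "\<zero>\<^bsub>A\<^esub> = (\<lambda>m. \<zero>)"
  and add_A: "f \<oplus>\<^bsub>A\<^esub> g = (\<lambda>m. f m \<oplus> g m)"
  and one_A: "\<one>\<^bsub>A\<^esub> = monomial R \<one> \<one>\<^bsub>M\<^esub>"
  by (simp_all add: monoid_ring_def monomial_def)

lemma mem_A_iff:
  "f \<in> carrier A \<longleftrightarrow> (\<forall>m. f m \<in> carrier R) \<and> supp f \<subseteq> carrier M \<and> finite (supp f)"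
  by (auto simp: monoid_ring_def monoid_ring_carrier_def)

lemma coeff_closed [simp]: "f \<in> carrier A \<Longrightarrow> f m \<in> carrier R"
  by (simp add: mem_A_iff)

lemma coeff_outside: "f \<in> carrier A \<Longrightarrow> m \<notin> carrier M \<Longrightarrow> f m = \<zero>"
  by (auto simp: mem_A_iff)

lemma zero_A_closed: "\<zero>\<^bsub>A\<^esub> \<in> carrier A"
  by (simp add: mem_A_iff zero_A)

lemma monomial_closed [simp]:
  "a \<in> carrier R \<Longrightarrow> x \<in> carrier M \<Longrightarrow> monomial R a x \<in> carrier A"
  by (auto simp: mem_A_iff monomial_def intro: finite_subset[of _ "{x}"])

lemma add_A_closed:
  assumes f: "f \<in> carrier A" and g: "g \<in> carrier A"
  shows "f \<oplus>\<^bsub>A\<^esub> g \<in> carrier A"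
proof -
  have "supp (f \<oplus>\<^bsub>A\<^esub> g) \<subseteq> supp f \<union> supp g" by (auto simp: add_A)
  moreover have "finite (supp f \<union> supp g)" "supp f \<union> supp g \<subseteq> carrier M"
    using f g by (auto simp: mem_A_iff)
  ultimately show ?thesis
    using f g finite_subset unfolding mem_A_iff by (auto simp: add_A)
qed

text \<open>Pairs outside the supports contribute zero, so any finite supersets may index the sum.
  This lets products of elements with different supports be compared over one index set.\<close>

lemma mult_A_eq_sum:
  assumes f: "f \<in> carrier A" and g: "g \<in> carrier A"
    and U: "finite U" "supp f \<subseteq> U" and V: "finite V" "supp g \<subseteq> V"
  shows "(f \<otimes>\<^bsub>A\<^esub> g) m =
    (\<Oplus>p \<in> {p \<in> U \<times> V. fst p \<otimes>\<^bsub>M\<^esub> snd p = m}. f (fst p) \<otimes> g (snd p))"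
proof -
  have "(f \<otimes>\<^bsub>A\<^esub> g) m =
      (\<Oplus>p \<in> {(x, y). f x \<noteq> \<zero> \<and> g y \<noteq> \<zero> \<and> x \<otimes>\<^bsub>M\<^esub> y = m}. f (fst p) \<otimes> g (snd p))"
    by (simp add: monoid_ring_def monoid_ring_mult_def)
  also have "\<dots> = (\<Oplus>p \<in> {p \<in> U \<times> V. fst p \<otimes>\<^bsub>M\<^esub> snd p = m}. f (fst p) \<otimes> g (snd p))"
    using f g U V by (intro R.add.finprod_mono_neutral_cong_left) auto
  finally show ?thesis .
qed

lemma mult_A_closed:
  assumes f: "f \<in> carrier A" and g: "g \<in> carrier A"
  shows "f \<otimes>\<^bsub>A\<^esub> g \<in> carrier A"
proof -
  have fin: "finite (supp f)" "finite (supp g)" "supp f \<subseteq> carrier M" "supp g \<subseteq> carrier M"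
    using f g by (auto simp: mem_A_iff)
  note eq = mult_A_eq_sum[OF f g fin(1) order_refl fin(2) order_refl]
  have "supp (f \<otimes>\<^bsub>A\<^esub> g) \<subseteq> (\<lambda>p. fst p \<otimes>\<^bsub>M\<^esub> snd p) ` (supp f \<times> supp g)"
  proof
    fix m assume "m \<in> supp (f \<otimes>\<^bsub>A\<^esub> g)"
    then have "{p \<in> supp f \<times> supp g. fst p \<otimes>\<^bsub>M\<^esub> snd p = m} \<noteq> {}"
      unfolding mem_Collect_eq[of m] eq[of m] by (intro notI) simp
    then show "m \<in> (\<lambda>p. fst p \<otimes>\<^bsub>M\<^esub> snd p) ` (supp f \<times> supp g)" by blast
  qed
  moreover have "finite ((\<lambda>p. fst p \<otimes>\<^bsub>M\<^esub> snd p) ` (supp f \<times> supp g))" using fin by simp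
  moreover have "(\<lambda>p. fst p \<otimes>\<^bsub>M\<^esub> snd p) ` (supp f \<times> supp g) \<subseteq> carrier M"
    using fin(3,4) by (auto intro!: M.m_closed simp: subset_iff)
  moreover have "(f \<otimes>\<^bsub>A\<^esub> g) m \<in> carrier R" for m
    unfolding eq using f g by (intro R.finsum_closed) auto
  ultimately show ?thesis
    unfolding mem_A_iff using finite_subset by blast
qed

lemma mult_A_comm:
  assumes f: "f \<in> carrier A" and g: "g \<in> carrier A"
  shows "f \<otimes>\<^bsub>A\<^esub> g = g \<otimes>\<^bsub>A\<^esub> f"
proof
  fix m
  have fin: "finite (supp f)" "finite (supp g)" "supp f \<subseteq> carrier M" "supp g \<subseteq> carrier M"
    using f g by (auto simp: mem_A_iff)
  let ?U = "{p \<in> supp f \<times> supp g. fst p \<otimes>\<^bsub>M\<^esub> snd p = m}"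
  let ?V = "{p \<in> supp g \<times> supp f. fst p \<otimes>\<^bsub>M\<^esub> snd p = m}"
  have comm: "x \<otimes>\<^bsub>M\<^esub> y = y \<otimes>\<^bsub>M\<^esub> x" if "x \<in> supp f" "y \<in> supp g" for x y
    using M.m_comm that fin by blast
  have V: "?V = prod.swap ` ?U"
    by (auto simp: image_iff comm)
  have "(g \<otimes>\<^bsub>A\<^esub> f) m = (\<Oplus>p \<in> ?V. g (fst p) \<otimes> f (snd p))"
    by (rule mult_A_eq_sum[OF g f fin(2) order_refl fin(1) order_refl])
  also have "\<dots> = (\<Oplus>p \<in> ?U. g (fst (prod.swap p)) \<otimes> f (snd (prod.swap p)))"
    unfolding V using f g by (intro R.finsum_reindex) (auto simp: inj_on_def)
  also have "\<dots> = (\<Oplus>p \<in> ?U. f (fst p) \<otimes> g (snd p))"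
    using f g by (intro R.finsum_cong') (auto simp: R.m_comm)
  also have "\<dots> = (f \<otimes>\<^bsub>A\<^esub> g) m"
    by (rule mult_A_eq_sum[OF f g fin(1) order_refl fin(2) order_refl, symmetric])
  finally show "(f \<otimes>\<^bsub>A\<^esub> g) m = (g \<otimes>\<^bsub>A\<^esub> f) m" ..
qed

lemma mult_A_l_distr:
  assumes f: "f \<in> carrier A" and g: "g \<in> carrier A" and h: "h \<in> carrier A"
  shows "(f \<oplus>\<^bsub>A\<^esub> g) \<otimes>\<^bsub>A\<^esub> h = f \<otimes>\<^bsub>A\<^esub> h \<oplus>\<^bsub>A\<^esub> g \<otimes>\<^bsub>A\<^esub> h"
proof
  fix m
  \<comment> \<open>Cancellation can make the support of the sum smaller than this union, so all
    three products are written over the union.\<close>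
  let ?X = "supp f \<union> supp g" and ?Y = "supp h"
  have X: "finite ?X" and Y: "finite ?Y" using f g h by (auto simp: mem_A_iff)
  have sub: "supp f \<subseteq> ?X" "supp g \<subseteq> ?X" "supp (f \<oplus>\<^bsub>A\<^esub> g) \<subseteq> ?X" by (auto simp: add_A)
  let ?U = "{p \<in> ?X \<times> ?Y. fst p \<otimes>\<^bsub>M\<^esub> snd p = m}"
  have "((f \<oplus>\<^bsub>A\<^esub> g) \<otimes>\<^bsub>A\<^esub> h) m = (\<Oplus>p \<in> ?U. (f (fst p) \<oplus> g (fst p)) \<otimes> h (snd p))"
    using mult_A_eq_sum[OF add_A_closed[OF f g] h X sub(3) Y order_refl] by (simp add: add_A)
  also have "\<dots> = (\<Oplus>p \<in> ?U. f (fst p) \<otimes> h (snd p) \<oplus> g (fst p) \<otimes> h (snd p))"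
    using f g h by (intro R.finsum_cong') (auto simp: R.l_distr)
  also have "\<dots> = (\<Oplus>p \<in> ?U. f (fst p) \<otimes> h (snd p)) \<oplus> (\<Oplus>p \<in> ?U. g (fst p) \<otimes> h (snd p))"
    using f g h by (intro R.finsum_addf) auto
  also have "\<dots> = (f \<otimes>\<^bsub>A\<^esub> h \<oplus>\<^bsub>A\<^esub> g \<otimes>\<^bsub>A\<^esub> h) m"
    using mult_A_eq_sum[OF f h X sub(1) Y order_refl] mult_A_eq_sum[OF g h X sub(2) Y order_refl]
    by (simp add: add_A)
  finally show "((f \<oplus>\<^bsub>A\<^esub> g) \<otimes>\<^bsub>A\<^esub> h) m = (f \<otimes>\<^bsub>A\<^esub> h \<oplus>\<^bsub>A\<^esub> g \<otimes>\<^bsub>A\<^esub> h) m" .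
qed

lemma mult_A_r_distr:
  assumes "f \<in> carrier A" "g \<in> carrier A" "h \<in> carrier A"
  shows "h \<otimes>\<^bsub>A\<^esub> (f \<oplus>\<^bsub>A\<^esub> g) = h \<otimes>\<^bsub>A\<^esub> f \<oplus>\<^bsub>A\<^esub> h \<otimes>\<^bsub>A\<^esub> g"
  using assms mult_A_l_distr[of f g h] by (simp add: mult_A_comm[of h] add_A_closed)

lemma mult_zero_A:
  assumes "f \<in> carrier A"
  shows "f \<otimes>\<^bsub>A\<^esub> \<zero>\<^bsub>A\<^esub> = \<zero>\<^bsub>A\<^esub>"
proof
  fix m
  have "(f \<otimes>\<^bsub>A\<^esub> \<zero>\<^bsub>A\<^esub>) m =
      (\<Oplus>p \<in> {p \<in> supp f \<times> {}. fst p \<otimes>\<^bsub>M\<^esub> snd p = m}. f (fst p) \<otimes> \<zero>\<^bsub>A\<^esub> (snd p))"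
    using assms zero_A_closed by (intro mult_A_eq_sum) (auto simp: mem_A_iff zero_A)
  then show "(f \<otimes>\<^bsub>A\<^esub> \<zero>\<^bsub>A\<^esub>) m = \<zero>\<^bsub>A\<^esub> m" by (simp add: zero_A)
qed

lemma monomial_mult_monomial:
  assumes a: "a \<in> carrier R" "b \<in> carrier R" and x: "x \<in> carrier M" "y \<in> carrier M"
  shows "monomial R a x \<otimes>\<^bsub>A\<^esub> monomial R b y = monomial R (a \<otimes> b) (x \<otimes>\<^bsub>M\<^esub> y)"
proof
  fix m
  have *: "{p \<in> {x} \<times> {y}. fst p \<otimes>\<^bsub>M\<^esub> snd p = m} = (if x \<otimes>\<^bsub>M\<^esub> y = m then {(x, y)} else {})"
    by auto
  have "(monomial R a x \<otimes>\<^bsub>A\<^esub> monomial R b y) m =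
      (\<Oplus>p \<in> {p \<in> {x} \<times> {y}. fst p \<otimes>\<^bsub>M\<^esub> snd p = m}. monomial R a x (fst p) \<otimes> monomial R b y (snd p))"
    using a x by (intro mult_A_eq_sum monomial_closed) (auto simp: monomial_def)
  also have "\<dots> = monomial R (a \<otimes> b) (x \<otimes>\<^bsub>M\<^esub> y) m"
    unfolding * using a by (auto simp: monomial_def)
  finally show "(monomial R a x \<otimes>\<^bsub>A\<^esub> monomial R b y) m = monomial R (a \<otimes> b) (x \<otimes>\<^bsub>M\<^esub> y) m" .
qed

text \<open>An element is the sum of its finitely many terms, added here one by one. The monomial
  case concerns only the terms of \<open>f\<close> itself, so what is known about the coefficients
  of \<open>f\<close> can be used there.\<close>

lemma monoid_ring_induct [consumes 1, case_names zero monomial add]: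
  assumes f: "f \<in> carrier A"
    and zero: "P \<zero>\<^bsub>A\<^esub>"
    and monomial: "\<And>x. x \<in> carrier M \<Longrightarrow> P (monomial R (f x) x)"
    and add: "\<And>g h. g \<in> carrier A \<Longrightarrow> h \<in> carrier A \<Longrightarrow> P g \<Longrightarrow> P h \<Longrightarrow> P (g \<oplus>\<^bsub>A\<^esub> h)"
  shows "P f"
proof -
  let ?r = "\<lambda>F m. if m \<in> F then f m else \<zero>"
  \<comment> \<open>\<open>?r F\<close> truncates \<open>f\<close> to the exponents in
    \<open>F\<close>. Its membership in the carrier is proved alongside, since \<open>add\<close>
    requires it.\<close>
  have "P (?r F) \<and> ?r F \<in> carrier A" if "finite F" "F \<subseteq> supp f" for F
    using that
  proof (induction F)
    case empty
    then show ?case using zero zero_A_closed by (simp add: zero_A)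
  next
    case (insert x F)
    have x: "x \<in> carrier M" using insert.prems f by (auto simp: mem_A_iff)
    have "?r (insert x F) = monomial R (f x) x \<oplus>\<^bsub>A\<^esub> ?r F"
      using insert f by (auto simp: add_A monomial_def)
    moreover have "P (?r F)" "?r F \<in> carrier A" using insert by auto
    moreover have "monomial R (f x) x \<in> carrier A" using f x by simp
    ultimately show ?case using add[of "monomial R (f x) x" "?r F"] monomial[OF x] add_A_closed
      by simp
  qed
  from this[of "supp f"] have "P (?r (supp f))" using f by (simp add: mem_A_iff)
  moreover have "?r (supp f) = f" by auto
  ultimately show ?thesis by simp
qed

text \<open>Both sides are additive in each argument, so inductions on \<open>h\<close>,
  \<open>g\<close> and \<open>f\<close> in turn reduce the claim to monomials, where it is
  associativity in \<open>R\<close> and in \<open>M\<close>.\<close>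

lemma mult_A_assoc:
  assumes f: "f \<in> carrier A" and g: "g \<in> carrier A" and h: "h \<in> carrier A"
  shows "(f \<otimes>\<^bsub>A\<^esub> g) \<otimes>\<^bsub>A\<^esub> h = f \<otimes>\<^bsub>A\<^esub> (g \<otimes>\<^bsub>A\<^esub> h)"
proof -
  have 0: "\<zero>\<^bsub>A\<^esub> \<otimes>\<^bsub>A\<^esub> u = \<zero>\<^bsub>A\<^esub>" if "u \<in> carrier A" for u
    using mult_zero_A[OF that] mult_A_comm[OF that zero_A_closed] by simp
  have 1: "(monomial R a x \<otimes>\<^bsub>A\<^esub> monomial R b y) \<otimes>\<^bsub>A\<^esub> h = monomial R a x \<otimes>\<^bsub>A\<^esub> (monomial R b y \<otimes>\<^bsub>A\<^esub> h)"
    if *: "a \<in> carrier R" "b \<in> carrier R" "x \<in> carrier M" "y \<in> carrier M" for a b x y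
    using h
  proof (induction rule: monoid_ring_induct)
    case zero
    then show ?case using * by (simp add: mult_zero_A mult_A_closed)
  next
    case (monomial z)
    then show ?case using * h by (simp add: monomial_mult_monomial R.m_assoc M.m_assoc)
  next
    case (add u v)
    then show ?case using * by (simp add: mult_A_r_distr mult_A_closed)
  qed
  have 2: "(monomial R a x \<otimes>\<^bsub>A\<^esub> g) \<otimes>\<^bsub>A\<^esub> h = monomial R a x \<otimes>\<^bsub>A\<^esub> (g \<otimes>\<^bsub>A\<^esub> h)"
    if *: "a \<in> carrier R" "x \<in> carrier M" for a x
    using g
  proof (induction rule: monoid_ring_induct)
    case zero
    then show ?case using * h by (simp add: mult_zero_A 0)
  next
    case (monomial z)
    then show ?case using * g by (simp add: 1)
  next
    case (add u v)
    then show ?case using * h by (simp add: mult_A_r_distr mult_A_l_distr mult_A_closed)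
  qed
  show ?thesis
    using f
  proof (induction rule: monoid_ring_induct)
    case zero
    then show ?case using g h by (simp add: mult_A_closed 0)
  next
    case (monomial z)
    then show ?case using f by (simp add: 2)
  next
    case (add u v)
    then show ?case using g h by (simp add: mult_A_l_distr mult_A_closed)
  qed
qed

lemma constant_mult_coeff:
  assumes a: "a \<in> carrier R" and f: "f \<in> carrier A"
  shows "(monomial R a \<one>\<^bsub>M\<^esub> \<otimes>\<^bsub>A\<^esub> f) m = a \<otimes> f m"
  using f
proof (induction rule: monoid_ring_induct)
  case zero
  then show ?case using a by (simp add: mult_zero_A) (simp add: zero_A)
next
  case (monomial x)
  then show ?case using a f by (simp add: monomial_mult_monomial) (simp add: monomial_def)
next
  case (add g h)
  then show ?case using a by (simp add: mult_A_r_distr) (simp add: add_A R.r_distr)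
qed

lemma cring_A: "cring A"
proof (rule cringI)
  show "abelian_group A"
  proof (rule abelian_groupI)
    fix f assume f: "f \<in> carrier A"
    let ?g = "\<lambda>m. \<ominus> f m"
    have "supp ?g = supp f" using f by (auto simp: R.add.inv_eq_1_iff)
    then have "?g \<in> carrier A" using f by (auto simp: mem_A_iff)
    moreover have "?g \<oplus>\<^bsub>A\<^esub> f = \<zero>\<^bsub>A\<^esub>" using f by (simp add: add_A zero_A R.l_neg)
    ultimately show "\<exists>g\<in>carrier A. g \<oplus>\<^bsub>A\<^esub> f = \<zero>\<^bsub>A\<^esub>" by blast
  next
    fix f g h assume "f \<in> carrier A" "g \<in> carrier A" "h \<in> carrier A"
    then show "f \<oplus>\<^bsub>A\<^esub> g \<oplus>\<^bsub>A\<^esub> h = f \<oplus>\<^bsub>A\<^esub> (g \<oplus>\<^bsub>A\<^esub> h)" by (simp add: add_A R.a_assoc)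
  next
    fix f g assume "f \<in> carrier A" "g \<in> carrier A"
    then show "f \<oplus>\<^bsub>A\<^esub> g = g \<oplus>\<^bsub>A\<^esub> f" by (simp add: add_A R.a_comm)
  next
    fix f assume "f \<in> carrier A"
    then show "\<zero>\<^bsub>A\<^esub> \<oplus>\<^bsub>A\<^esub> f = f" by (simp add: add_A zero_A)
  qed (fact add_A_closed zero_A_closed)+
  show "comm_monoid A"
  proof (rule comm_monoidI)
    show "\<one>\<^bsub>A\<^esub> \<in> carrier A" by (simp add: one_A)
    fix f assume "f \<in> carrier A"
    then show "\<one>\<^bsub>A\<^esub> \<otimes>\<^bsub>A\<^esub> f = f" by (auto simp: one_A constant_mult_coeff)
  qed (fact mult_A_closed mult_A_assoc mult_A_comm)+
qed (fact mult_A_l_distr)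

end

sublocale comm_monoid_ring \<subseteq> A: cring "monoid_ring R M"
  by (rule cring_A)

context comm_monoid_ring
begin

section \<open>Extension of coefficient sets and contraction along the constants\<close>

lemma constant_hom: "ring_hom_ring R A (\<lambda>a. monomial R a \<one>\<^bsub>M\<^esub>)"
proof (rule ring_hom_ringI)
  show "ring R" "ring A" by unfold_locales
qed (auto simp: monomial_mult_monomial add_A one_A, auto simp: monomial_def)

lemma coeffs_in_iff: "f \<in> coeffs_in R M I \<longleftrightarrow> f \<in> carrier A \<and> (\<forall>m\<in>carrier M. f m \<in> I)"
  by (simp add: coeffs_in_def)

lemma coeffs_in_coeff:
  "f \<in> coeffs_in R M I \<Longrightarrow> \<zero> \<in> I \<Longrightarrow> f m \<in> I"
  by (cases "m \<in> carrier M") (auto simp: coeffs_in_iff coeff_outside)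

text \<open>Coefficients outside the carrier of \<open>M\<close> are zero, so once \<open>I\<close>
  contains zero the exponent may range over the whole type.\<close>

lemma coeffs_in_iff':
  "\<zero> \<in> I \<Longrightarrow> f \<in> coeffs_in R M I \<longleftrightarrow> f \<in> carrier A \<and> (\<forall>m. f m \<in> I)"
  using coeffs_in_coeff[of f I] by (auto simp: coeffs_in_iff)

lemma monomial_in_coeffs_in_iff:
  assumes "I \<subseteq> carrier R" "\<zero> \<in> I" "x \<in> carrier M" "a \<in> carrier R"
  shows "monomial R a x \<in> coeffs_in R M I \<longleftrightarrow> a \<in> I"
  using assms by (simp add: coeffs_in_iff) (auto simp: monomial_def)

lemma coeffs_in_mono: "I \<subseteq> J \<Longrightarrow> coeffs_in R M I \<subseteq> coeffs_in R M J"
  unfolding coeffs_in_def by blast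

lemma coeffs_in_zero: "coeffs_in R M {\<zero>} = {\<zero>\<^bsub>A\<^esub>}"
proof -
  have "f \<in> coeffs_in R M {\<zero>} \<longleftrightarrow> f = \<zero>\<^bsub>A\<^esub>" for f
    using A.zero_closed by (auto simp: coeffs_in_iff' zero_A)
  then show ?thesis by blast
qed

text \<open>Each coefficient of a product is a finite sum of terms having a factor in
  \<open>I\<close>. Negatives are obtained as multiples by minus one.\<close>

lemma coeffs_in_ideal:
  assumes I: "ideal I R"
  shows "ideal (coeffs_in R M I) A"
proof -
  interpret I: ideal I R by fact
  note iff = coeffs_in_iff'[OF I.zero_closed]
  have closed: "f \<otimes>\<^bsub>A\<^esub> g \<in> coeffs_in R M I" if f: "f \<in> carrier A" and g: "g \<in> coeffs_in R M I" for f g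
  proof -
    have g': "g \<in> carrier A" "\<And>m. g m \<in> I" using g by (auto simp: iff)
    have fin: "finite (supp f)" "finite (supp g)" using f g' by (auto simp: mem_A_iff)
    have "(f \<otimes>\<^bsub>A\<^esub> g) m \<in> I" for m
      unfolding mult_A_eq_sum[OF f g'(1) fin(1) order_refl fin(2) order_refl]
      using fin f g' by (intro finsum_in_ideal[OF I]) (auto intro!: I.I_l_closed)
    then show ?thesis using f g' by (simp add: iff)
  qed
  show ?thesis
  proof (rule idealI[OF A.ring_axioms])
    show "subgroup (coeffs_in R M I) (add_monoid A)"
    proof (rule group.subgroupI[OF A.add.is_group])
      show "coeffs_in R M I \<subseteq> carrier (add_monoid A)" by (auto simp: coeffs_in_iff)
      have "\<zero>\<^bsub>A\<^esub> \<in> coeffs_in R M I" using A.zero_closed by (simp add: iff) (simp add: zero_A)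
      then show "coeffs_in R M I \<noteq> {}" by blast
    next
      fix f assume f: "f \<in> coeffs_in R M I"
      then have "(\<ominus>\<^bsub>A\<^esub> \<one>\<^bsub>A\<^esub>) \<otimes>\<^bsub>A\<^esub> f \<in> coeffs_in R M I" by (intro closed) auto
      moreover have "(\<ominus>\<^bsub>A\<^esub> \<one>\<^bsub>A\<^esub>) \<otimes>\<^bsub>A\<^esub> f = \<ominus>\<^bsub>A\<^esub> f" using f by (simp add: iff A.l_minus)
      ultimately show "inv\<^bsub>add_monoid A\<^esub> f \<in> coeffs_in R M I" by (simp add: a_inv_def)
    next
      fix f g assume "f \<in> coeffs_in R M I" "g \<in> coeffs_in R M I"
      then show "f \<otimes>\<^bsub>add_monoid A\<^esub> g \<in> coeffs_in R M I"
        by (auto simp: iff) (simp add: add_A)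
    qed
  next
    fix f g assume "f \<in> coeffs_in R M I" "g \<in> carrier A"
    then show "g \<otimes>\<^bsub>A\<^esub> f \<in> coeffs_in R M I" "f \<otimes>\<^bsub>A\<^esub> g \<in> coeffs_in R M I"
      using closed[of g f] A.m_comm[of f g] by (auto simp: coeffs_in_iff)
  qed
qed

text \<open>The preimage of \<open>Q\<close> under the ring homomorphism of
  \<open>constant_hom\<close>; hence primes contract to primes.\<close>

definition contraction :: "('m \<Rightarrow> 'a) set \<Rightarrow> 'a set" where
  "contraction Q = {a \<in> carrier R. monomial R a \<one>\<^bsub>M\<^esub> \<in> Q}"

lemma contraction_prime: "primeideal Q A \<Longrightarrow> primeideal (contraction Q) R"
  using ring_hom_ring.primeideal_vimage[OF constant_hom R.is_cring, of Q]
  by (simp add: contraction_def)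

lemma contraction_coeffs_in:
  "I \<subseteq> carrier R \<Longrightarrow> \<zero> \<in> I \<Longrightarrow> contraction (coeffs_in R M I) = I"
  by (auto simp: contraction_def monomial_in_coeffs_in_iff subset_iff)

lemma contraction_mono: "P \<subseteq> Q \<Longrightarrow> contraction P \<subseteq> contraction Q"
  by (auto simp: contraction_def)

text \<open>Every term of such an element is a basis element times a constant in \<open>Q\<close>,
  and \<open>Q\<close> absorbs the basis element.\<close>

lemma coeffs_in_contraction_subset:
  assumes Q: "ideal Q A"
  shows "coeffs_in R M (contraction Q) \<subseteq> Q"
proof
  interpret Q: ideal Q A by fact
  fix f assume f: "f \<in> coeffs_in R M (contraction Q)"
  then have "f \<in> carrier A" by (simp add: coeffs_in_iff)
  then show "f \<in> Q"
  proof (induction rule: monoid_ring_induct)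
    case (monomial x)
    then have "monomial R (f x) \<one>\<^bsub>M\<^esub> \<in> Q" using f by (simp add: coeffs_in_iff contraction_def)
    then have "monomial R \<one> x \<otimes>\<^bsub>A\<^esub> monomial R (f x) \<one>\<^bsub>M\<^esub> \<in> Q"
      using monomial by (intro Q.I_l_closed) auto
    then show ?case using monomial f by (simp add: monomial_mult_monomial coeffs_in_iff)
  qed (auto intro: Q.zero_closed)
qed

end

section \<open>Totally ordered cancellative exponents\<close>

locale ordered_monoid_ring = comm_monoid_ring R M + totally_ordered_monoid M lt + comm_monoid_cancel M
  for R :: "('a, 'b) ring_scheme" (structure) and M :: "('m, 'c) monoid_scheme" (structure)
    and lt :: "('m \<times> 'm) set"
begin

section \<open>Strict translation and extremal exponents\<close>

lemma lt_trans: "(a, b) \<in> lt \<Longrightarrow> (b, c) \<in> lt \<Longrightarrow> (a, c) \<in> lt"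
  using strict_total_order by (auto simp: strict_linear_order_on_def dest: transD)

lemma lt_irrefl: "(a, a) \<notin> lt"
  using strict_total_order by (auto simp: strict_linear_order_on_def irrefl_def)

lemma lt_total: "a \<in> carrier M \<Longrightarrow> b \<in> carrier M \<Longrightarrow> a = b \<or> (a, b) \<in> lt \<or> (b, a) \<in> lt"
  using strict_total_order by (auto simp: strict_linear_order_on_def total_on_def)

text \<open>The order axiom gives weak monotonicity only; cancellation rules out equality of the
  translates.\<close>

lemma strict_translate:
  assumes "a \<in> carrier M" "b \<in> carrier M" "x \<in> carrier M" "(a, b) \<in> lt"
  shows "(a \<otimes>\<^bsub>M\<^esub> x, b \<otimes>\<^bsub>M\<^esub> x) \<in> lt"
  using translate[OF assms] r_cancel[of a x b] assms lt_irrefl by auto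

lemma ex_lt_max:
  assumes "finite F" "F \<noteq> {}" "F \<subseteq> carrier M"
  shows "\<exists>m\<in>F. \<forall>x\<in>F. (m, x) \<notin> lt"
  using assms
proof (induction F rule: finite_ne_induct)
  case (singleton x)
  then show ?case using lt_irrefl by simp
next
  case (insert x F)
  then obtain m where m: "m \<in> F" "\<forall>x\<in>F. (m, x) \<notin> lt" by auto
  show ?case
  proof (cases "(m, x) \<in> lt")
    case True
    then have "\<forall>y\<in>insert x F. (x, y) \<notin> lt" using m lt_trans lt_irrefl by blast
    then show ?thesis by blast
  next
    case False
    then show ?thesis using m by auto
  qed
qed

text \<open>If neither component exceeded, replacing \<open>x'\<close> by \<open>x\<close> and then
  \<open>y'\<close> by \<open>y\<close> would never decrease the sum and would increase it strictly
  at least once.\<close>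

lemma other_decomposition_exceeds:
  assumes c: "x \<in> carrier M" "y \<in> carrier M" "x' \<in> carrier M" "y' \<in> carrier M"
    and eq: "x' \<otimes>\<^bsub>M\<^esub> y' = x \<otimes>\<^bsub>M\<^esub> y" and ne: "(x', y') \<noteq> (x, y)"
  shows "(x, x') \<in> lt \<or> (y, y') \<in> lt"
proof (rule ccontr)
  assume neg: "\<not> ?thesis"
  have 1: "x' = x \<or> (x' \<otimes>\<^bsub>M\<^esub> y', x \<otimes>\<^bsub>M\<^esub> y') \<in> lt"
    using neg lt_total[of x' x] strict_translate[of x' x y'] c by auto
  have 2: "y' = y \<or> (x \<otimes>\<^bsub>M\<^esub> y', x \<otimes>\<^bsub>M\<^esub> y) \<in> lt"
    using neg lt_total[of y' y] strict_translate[of y' y x] c by (auto simp: M.m_comm)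
  have "(x' \<otimes>\<^bsub>M\<^esub> y', x \<otimes>\<^bsub>M\<^esub> y) \<in> lt"
    using 1 2 ne lt_trans by blast
  then show False using eq lt_irrefl by simp
qed

text \<open>The coefficient at the exponent \<open>x \<otimes> y\<close> is
  \<open>f x \<otimes> g y\<close> plus terms from other decompositions, all in \<open>I\<close> by
  \<open>above\<close>. That hypothesis concerns products of coefficients, so it fits both a prime
  containing one factor and the zero ideal, where a coefficient of \<open>f\<close> may merely kill
  those of \<open>g\<close>.\<close>

lemma extremal_coeff_product:
  assumes I: "ideal I R" and f: "f \<in> carrier A" and g: "g \<in> carrier A"
    and x: "x \<in> carrier M" and y: "y \<in> carrier M"
    and above: "\<And>x' y'. (x, x') \<in> lt \<or> (y, y') \<in> lt \<Longrightarrow> f x' \<otimes> g y' \<in> I"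
    and fg: "(f \<otimes>\<^bsub>A\<^esub> g) (x \<otimes>\<^bsub>M\<^esub> y) \<in> I"
  shows "f x \<otimes> g y \<in> I"
proof -
  interpret I: ideal I R by fact
  \<comment> \<open>\<open>x\<close> and \<open>y\<close> are inserted because their coefficients
    may vanish, while the pair \<open>(x, y)\<close> has to occur in the sum.\<close>
  let ?U = "insert x (supp f)" and ?V = "insert y (supp g)"
  have U: "finite ?U" "supp f \<subseteq> ?U" and V: "finite ?V" "supp g \<subseteq> ?V"
    and carr: "?U \<subseteq> carrier M" "?V \<subseteq> carrier M"
    using f g x y by (auto simp: mem_A_iff)
  define D where "D = {p \<in> ?U \<times> ?V. fst p \<otimes>\<^bsub>M\<^esub> snd p = x \<otimes>\<^bsub>M\<^esub> y}"
  define h where "h p = f (fst p) \<otimes> g (snd p)" for p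
  have fin: "finite D" unfolding D_def using U V by simp
  have D: "D = insert (x, y) (D - {(x, y)})" by (auto simp: D_def)
  have hc: "h p \<in> carrier R" for p using f g by (simp add: h_def)
  have rest: "(\<Oplus>p \<in> D - {(x, y)}. h p) \<in> I"
  proof (rule finsum_in_ideal[OF I])
    fix p assume p: "p \<in> D - {(x, y)}"
    then have "(x, fst p) \<in> lt \<or> (y, snd p) \<in> lt"
      using carr x y unfolding D_def
      by (intro other_decomposition_exceeds) (auto simp: prod_eq_iff subset_iff)
    then show "h p \<in> I" unfolding h_def by (rule above)
  qed (use fin in simp)
  have "(f \<otimes>\<^bsub>A\<^esub> g) (x \<otimes>\<^bsub>M\<^esub> y) = (\<Oplus>p \<in> D. h p)"
    unfolding D_def h_def by (rule mult_A_eq_sum[OF f g U V])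
  also have "\<dots> = h (x, y) \<oplus> (\<Oplus>p \<in> D - {(x, y)}. h p)"
    using hc fin by (subst D, intro R.finsum_insert) auto
  finally have "h (x, y) = (f \<otimes>\<^bsub>A\<^esub> g) (x \<otimes>\<^bsub>M\<^esub> y) \<ominus> (\<Oplus>p \<in> D - {(x, y)}. h p)"
    using hc by (simp add: R.minus_eq R.a_assoc R.r_neg)
  also have "\<dots> \<in> I"
    using fg rest by (simp add: R.minus_eq)
  finally show ?thesis by (simp add: h_def)
qed

section \<open>Primes, minimal primes and nilpotents of the monoid ring\<close>

lemma coeffs_in_prime:
  assumes P: "primeideal P R"
  shows "primeideal (coeffs_in R M P) A"
proof -
  interpret P: primeideal P R by fact
  note iff = coeffs_in_iff'[OF P.zero_closed]
  have top: "\<exists>x\<in>carrier M. f x \<notin> P \<and> (\<forall>x'. (x, x') \<in> lt \<longrightarrow> f x' \<in> P)"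
    if f: "f \<in> carrier A" "f \<notin> coeffs_in R M P" for f
  proof -
    \<comment> \<open>Coefficients outside \<open>P\<close> are nonzero, so only finitely many
      exponents compete for the maximum.\<close>
    have sub: "{x. f x \<notin> P} \<subseteq> supp f" using P.zero_closed by auto
    have "finite {x. f x \<notin> P}" "{x. f x \<notin> P} \<subseteq> carrier M"
      using f sub finite_subset by (auto simp: mem_A_iff)
    moreover have "{x. f x \<notin> P} \<noteq> {}" using f by (auto simp: iff)
    ultimately show ?thesis using ex_lt_max[of "{x. f x \<notin> P}"] by blast
  qed
  show ?thesis
  proof (rule primeidealI[OF coeffs_in_ideal[OF P.is_ideal] cring_A])
    have "\<one> \<notin> P" using P.one_imp_carrier P.I_notcarr by auto
    then have "\<one>\<^bsub>A\<^esub> \<notin> coeffs_in R M P"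
      using P.a_subset P.zero_closed by (simp add: one_A monomial_in_coeffs_in_iff)
    then show "carrier A \<noteq> coeffs_in R M P" by auto
    fix f g assume fg: "f \<in> carrier A" "g \<in> carrier A" "f \<otimes>\<^bsub>A\<^esub> g \<in> coeffs_in R M P"
    show "f \<in> coeffs_in R M P \<or> g \<in> coeffs_in R M P"
    proof (rule ccontr)
      assume neg: "\<not> ?thesis"
      obtain x where x: "x \<in> carrier M" "f x \<notin> P" "\<forall>x'. (x, x') \<in> lt \<longrightarrow> f x' \<in> P"
        using top[of f] fg neg by blast
      obtain y where y: "y \<in> carrier M" "g y \<notin> P" "\<forall>y'. (y, y') \<in> lt \<longrightarrow> g y' \<in> P"
        using top[of g] fg neg by blast
      have "f x \<otimes> g y \<in> P"
      proof (rule extremal_coeff_product[OF P.is_ideal fg(1,2) x(1) y(1)])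
        show "(f \<otimes>\<^bsub>A\<^esub> g) (x \<otimes>\<^bsub>M\<^esub> y) \<in> P" using fg by (simp add: iff)
        fix x' y' assume "(x, x') \<in> lt \<or> (y, y') \<in> lt"
        then have "f x' \<in> P \<or> g y' \<in> P" using x y by blast
        then show "f x' \<otimes> g y' \<in> P"
          using fg P.I_l_closed P.I_r_closed by auto
      qed
      then show False
        using x(2) y(2) P.I_prime[OF coeff_closed[OF fg(1)] coeff_closed[OF fg(2)]] by blast
    qed
  qed
qed

text \<open>For the forward direction, \<open>P\<close> is the contraction of its own extension as
  soon as it contains zero, and contractions of primes are prime.\<close>

lemma coeffs_in_prime_iff:
  assumes sub: "P \<subseteq> carrier R"
  shows "primeideal (coeffs_in R M P) A \<longleftrightarrow> primeideal P R"
proof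
  assume *: "primeideal (coeffs_in R M P) A"
  then have "\<zero>\<^bsub>A\<^esub> \<in> coeffs_in R M P"
    by (simp add: additive_subgroup.zero_closed ideal.axioms(1) primeideal.axioms(1))
  \<comment> \<open>The carrier of \<open>M\<close> contains its unit, so the condition on
    coefficients is not vacuous.\<close>
  then have "\<zero> \<in> P" by (auto simp: coeffs_in_iff zero_A)
  then show "primeideal P R"
    using contraction_prime[OF *] contraction_coeffs_in[OF sub] by simp
qed (rule coeffs_in_prime)

lemma contraction_of_extension: "primeideal P R \<Longrightarrow> contraction (coeffs_in R M P) = P"
  by (meson additive_subgroup.a_subset additive_subgroup.zero_closed contraction_coeffs_in
      ideal.axioms(1) primeideal.axioms(1))

text \<open>The extension of the contraction of a prime \<open>Q\<close> is a prime inside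
  \<open>Q\<close>, so it equals \<open>Q\<close> when \<open>Q\<close> is minimal. Conversely, a
  prime below the extension of a minimal \<open>P\<close> contracts to \<open>P\<close> and
  therefore contains that extension.\<close>

lemma minimal_primes:
  "{Q. minimal_prime A Q} = {coeffs_in R M P | P. minimal_prime R P}"
proof (intro equalityI subsetI)
  fix Q assume "Q \<in> {Q. minimal_prime A Q}"
  then have Q: "primeideal Q A" and min: "\<And>Q'. primeideal Q' A \<Longrightarrow> Q' \<subseteq> Q \<Longrightarrow> Q' = Q"
    by (auto simp: minimal_prime_def prime_spec_def)
  have eq: "coeffs_in R M (contraction Q) = Q"
    using Q by (intro min coeffs_in_prime contraction_prime coeffs_in_contraction_subset primeideal.axioms(1))
  have "P = contraction Q" if P: "primeideal P R" "P \<subseteq> contraction Q" for P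
  proof -
    have "coeffs_in R M P = Q"
      using P coeffs_in_mono[OF P(2)] eq by (intro min coeffs_in_prime) auto
    then show ?thesis using contraction_of_extension P by blast
  qed
  then have "minimal_prime R (contraction Q)"
    using contraction_prime[OF Q] by (simp add: minimal_prime_def prime_spec_def)
  then show "Q \<in> {coeffs_in R M P | P. minimal_prime R P}" using eq by blast
next
  fix Q assume "Q \<in> {coeffs_in R M P | P. minimal_prime R P}"
  then obtain P where Q: "Q = coeffs_in R M P" and P: "primeideal P R"
    and min: "\<And>P'. primeideal P' R \<Longrightarrow> P' \<subseteq> P \<Longrightarrow> P' = P"
    by (auto simp: minimal_prime_def prime_spec_def)
  have "Q' = Q" if Q': "primeideal Q' A" "Q' \<subseteq> Q" for Q'
  proof -
    have "contraction Q' \<subseteq> P"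
      using contraction_mono[OF Q'(2)] contraction_of_extension[OF P] by (simp add: Q)
    then have "contraction Q' = P" using Q' by (intro min contraction_prime)
    then show ?thesis
      using coeffs_in_contraction_subset[OF primeideal.axioms(1)[OF Q'(1)]] Q' by (auto simp: Q)
  qed
  then show "Q \<in> {Q. minimal_prime A Q}"
    using coeffs_in_prime[OF P] by (auto simp: minimal_prime_def prime_spec_def Q)
qed

text \<open>Every prime of \<open>A\<close> contains an extended prime, so the extended primes
  suffice as a test.\<close>

lemma nilpotent_A_iff_primes:
  assumes f: "f \<in> carrier A"
  shows "nilpotent A f \<longleftrightarrow> (\<forall>P. primeideal P R \<longrightarrow> f \<in> coeffs_in R M P)"
  unfolding A.nilpotent_iff_primes[OF f]
  using coeffs_in_prime contraction_prime coeffs_in_contraction_subset primeideal.axioms(1) by blast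

lemma nilradical_A: "nilradical A = coeffs_in R M (nilradical R)"
proof -
  have "f \<in> nilradical A \<longleftrightarrow> f \<in> coeffs_in R M (nilradical R)" for f
  proof (cases "f \<in> carrier A")
    case True
    then show ?thesis
      by (auto simp: nilradical_def nilpotent_A_iff_primes R.nilpotent_iff_primes coeffs_in_iff)
  next
    case False
    then show ?thesis by (auto simp: nilradical_def nilpotent_def coeffs_in_iff)
  qed
  then show ?thesis by blast
qed

text \<open>For a fixed prime \<open>P\<close>, both conditions say that \<open>f\<close> or
  \<open>g\<close> has all its coefficients in \<open>P\<close>: the first because the extension is
  prime, the second because one coefficient of \<open>f\<close> outside \<open>P\<close> forces
  every coefficient of \<open>g\<close> into \<open>P\<close>.\<close>

lemma nilpotent_mult_A_iff:
  assumes f: "f \<in> carrier A" and g: "g \<in> carrier A"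
  shows "nilpotent A (f \<otimes>\<^bsub>A\<^esub> g) \<longleftrightarrow>
    (\<forall>x\<in>carrier M. \<forall>y\<in>carrier M. nilpotent R (f x \<otimes> g y))"
proof -
  have *: "f \<otimes>\<^bsub>A\<^esub> g \<in> coeffs_in R M P \<longleftrightarrow> (\<forall>x\<in>carrier M. \<forall>y\<in>carrier M. f x \<otimes> g y \<in> P)"
    if P: "primeideal P R" for P
  proof -
    interpret P: primeideal P R by fact
    interpret Q: primeideal "coeffs_in R M P" A using P by (rule coeffs_in_prime)
    have "f \<otimes>\<^bsub>A\<^esub> g \<in> coeffs_in R M P \<longleftrightarrow> f \<in> coeffs_in R M P \<or> g \<in> coeffs_in R M P"
      using f g Q.I_prime Q.I_l_closed Q.I_r_closed by blast
    moreover have "f x \<otimes> g y \<in> P \<longleftrightarrow> f x \<in> P \<or> g y \<in> P" for x y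
      using coeff_closed[OF f] coeff_closed[OF g] P.I_prime P.I_l_closed P.I_r_closed by blast
    ultimately show ?thesis using f g by (auto simp: coeffs_in_iff)
  qed
  have "nilpotent A (f \<otimes>\<^bsub>A\<^esub> g) \<longleftrightarrow>
      (\<forall>P. primeideal P R \<longrightarrow> (\<forall>x\<in>carrier M. \<forall>y\<in>carrier M. f x \<otimes> g y \<in> P))"
    using f g * by (simp add: nilpotent_A_iff_primes)
  then show ?thesis using f g by (auto simp: R.nilpotent_iff_primes)
qed

section \<open>McCoy's theorem and zero-divisors\<close>

text \<open>Induction on the size of the support of \<open>g\<close>. If every coefficient of
  \<open>f\<close> kills \<open>g\<close>, any nonzero coefficient of \<open>g\<close> serves as
  \<open>r\<close>. Otherwise a suitable coefficient \<open>f x\<close> gives a nonzero multiple of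
  \<open>g\<close> that \<open>f\<close> still kills and that has lost the top exponent of
  \<open>g\<close>.\<close>

lemma annihilated_by_constant:
  assumes "f \<in> carrier A" "g \<in> carrier A" "g \<noteq> \<zero>\<^bsub>A\<^esub>" "f \<otimes>\<^bsub>A\<^esub> g = \<zero>\<^bsub>A\<^esub>"
  shows "\<exists>r\<in>carrier R. r \<noteq> \<zero> \<and> (\<forall>x. f x \<otimes> r = \<zero>)"
  using assms
proof (induction "card (supp g)" arbitrary: g rule: less_induct)
  case less
  note f = less.prems(1) and g = less.prems(2)
  have gs: "finite (supp g)" "supp g \<subseteq> carrier M" "supp g \<noteq> {}"
    using less.prems by (auto simp: mem_A_iff zero_A fun_eq_iff)
  show ?case
  proof (cases "\<forall>x m. f x \<otimes> g m = \<zero>")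
    case True
    then show ?thesis using gs g by auto
  next
    case False
    \<comment> \<open>The maximum is taken over the exponents whose coefficient does not kill
      \<open>g\<close>, not over the whole support of \<open>f\<close>. This keeps \<open>?h\<close>
      nonzero, and all coefficients of \<open>f\<close> beyond \<open>x\<close> kill
      \<open>g\<close>.\<close>
    let ?F = "{x. \<exists>m. f x \<otimes> g m \<noteq> \<zero>}"
    have "?F \<subseteq> supp f" using g by auto
    then have "finite ?F" "?F \<subseteq> carrier M"
      using f finite_subset[of ?F "supp f"] by (auto simp: mem_A_iff)
    moreover have "?F \<noteq> {}" using False by blast
    ultimately obtain x where x: "x \<in> carrier M" "x \<in> ?F" "\<forall>x'\<in>?F. (x, x') \<notin> lt"
      using ex_lt_max[of ?F] by blast
    obtain y where y: "y \<in> supp g" "\<forall>y'\<in>supp g. (y, y') \<notin> lt"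
      using ex_lt_max gs by blast
    have "f x \<otimes> g y \<in> {\<zero>}"
    proof (rule extremal_coeff_product[OF R.zeroideal f g x(1)])
      show "y \<in> carrier M" using y gs by blast
      show "(f \<otimes>\<^bsub>A\<^esub> g) (x \<otimes>\<^bsub>M\<^esub> y) \<in> {\<zero>}" using less.prems by (simp add: zero_A)
      fix x' y' assume "(x, x') \<in> lt \<or> (y, y') \<in> lt"
      then have "x' \<notin> ?F \<or> g y' = \<zero>" using x y by blast
      then show "f x' \<otimes> g y' \<in> {\<zero>}" using f by auto
    qed
    then have fxgy: "f x \<otimes> g y = \<zero>" by simp
    let ?c = "monomial R (f x) \<one>\<^bsub>M\<^esub>"
    let ?h = "?c \<otimes>\<^bsub>A\<^esub> g"
    have c: "?c \<in> carrier A" using f by simp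
    have h: "?h m = f x \<otimes> g m" for m using f g by (simp add: constant_mult_coeff)
    have "supp ?h \<subset> supp g"
    proof
      show "supp ?h \<subseteq> supp g" using f by (auto simp: h)
      show "supp ?h \<noteq> supp g" using y(1) fxgy by (force simp: h)
    qed
    then have "card (supp ?h) < card (supp g)" using gs by (intro psubset_card_mono)
    moreover have "?h \<noteq> \<zero>\<^bsub>A\<^esub>"
    proof
      assume "?h = \<zero>\<^bsub>A\<^esub>"
      then have "f x \<otimes> g m = \<zero>" for m using h[of m] by (simp add: zero_A)
      then show False using x(2) by simp
    qed
    moreover have "f \<otimes>\<^bsub>A\<^esub> ?h = \<zero>\<^bsub>A\<^esub>"
    proof -
      have "f \<otimes>\<^bsub>A\<^esub> ?h = ?c \<otimes>\<^bsub>A\<^esub> (f \<otimes>\<^bsub>A\<^esub> g)" by (rule A.m_lcomm[OF f c g])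
      then show ?thesis using less.prems c by simp
    qed
    ultimately show ?thesis using less.hyps[of ?h] f g c by blast
  qed
qed

text \<open>The annihilator \<open>J\<close> of the nonzero constant \<open>r\<close> is proper and
  contains all coefficients of \<open>f\<close>; any prime above \<open>J\<close> works.\<close>

lemma zero_divisors_A_subset:
  "zero_divisors A \<subseteq> (\<Union>P \<in> prime_spec R. coeffs_in R M P)"
proof
  fix f assume "f \<in> zero_divisors A"
  then obtain g where f: "f \<in> carrier A" and g: "g \<in> carrier A" "g \<noteq> \<zero>\<^bsub>A\<^esub>" "f \<otimes>\<^bsub>A\<^esub> g = \<zero>\<^bsub>A\<^esub>"
    by (auto simp: zero_divisors_def)
  obtain r where r: "r \<in> carrier R" "r \<noteq> \<zero>" "\<forall>x. f x \<otimes> r = \<zero>"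
    using annihilated_by_constant[OF f g] by blast
  define J where "J = {a \<in> carrier R. a \<otimes> r = \<zero>}"
  have "ideal J R"
  proof (rule idealI[OF R.ring_axioms])
    show "subgroup J (add_monoid R)"
      by (rule group.subgroupI[OF R.add.is_group])
        (use r in \<open>auto simp: J_def R.l_distr R.l_minus a_inv_def[symmetric] intro: exI[of _ \<zero>]\<close>)
    fix a x assume a: "a \<in> J" and x: "x \<in> carrier R"
    show xa: "x \<otimes> a \<in> J" using a x r by (auto simp: J_def R.m_assoc)
    then show "a \<otimes> x \<in> J" using a x by (simp add: J_def R.m_comm[of a x])
  qed
  moreover have "J \<inter> {\<one>} = {}" using r by (auto simp: J_def)
  \<comment> \<open>With the multiplicative set reduced to the identity, the avoidance lemma places
    a proper ideal inside a prime.\<close>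
  ultimately obtain P where P: "primeideal P R" "J \<subseteq> P"
    using R.exists_prime_disjoint[of J "{\<one>}"] by auto
  have "f \<in> coeffs_in R M P" using f r P by (auto simp: coeffs_in_iff J_def)
  then show "f \<in> (\<Union>P \<in> prime_spec R. coeffs_in R M P)" using P by (auto simp: prime_spec_def)
qed

text \<open>Every prime is now minimal, so the finitely many nonzero coefficients of
  \<open>f\<close> share a nonzero annihilator \<open>c\<close>, and the constant \<open>c\<close>
  kills \<open>f\<close>. For the zero ring both sides are empty.\<close>

lemma zero_divisors_A_if_krull_dim_0:
  assumes "krull_dim R = 0"
  shows "zero_divisors A = (\<Union>P \<in> prime_spec R. coeffs_in R M P)"
proof
  show "(\<Union>P \<in> prime_spec R. coeffs_in R M P) \<subseteq> zero_divisors A"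
  proof clarify
    fix P f assume P: "P \<in> prime_spec R" and fP: "f \<in> coeffs_in R M P"
    then have P': "primeideal P R" by (simp add: prime_spec_def)
    interpret P: primeideal P R by fact
    have f: "f \<in> carrier A" "\<And>m. f m \<in> P" using fP P.zero_closed by (auto simp: coeffs_in_iff')
    have "finite (f ` supp f)" "f ` supp f \<subseteq> P" using f by (auto simp: mem_A_iff)
    then obtain c where c: "c \<in> carrier R" "c \<noteq> \<zero>" "\<forall>a\<in>f ` supp f. c \<otimes> a = \<zero>"
      using R.finite_subset_minimal_prime_annihilated[OF minimal_prime_if_krull_dim_0[OF assms P']]
      by blast
    have "monomial R c \<one>\<^bsub>M\<^esub> \<otimes>\<^bsub>A\<^esub> f = \<zero>\<^bsub>A\<^esub>"
    proof
      fix m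
      show "(monomial R c \<one>\<^bsub>M\<^esub> \<otimes>\<^bsub>A\<^esub> f) m = \<zero>\<^bsub>A\<^esub> m"
        using c f by (cases "f m = \<zero>") (auto simp: constant_mult_coeff zero_A)
    qed
    then have "f \<otimes>\<^bsub>A\<^esub> monomial R c \<one>\<^bsub>M\<^esub> = \<zero>\<^bsub>A\<^esub>" using c f by (simp add: A.m_comm)
    moreover have "monomial R c \<one>\<^bsub>M\<^esub> \<noteq> \<zero>\<^bsub>A\<^esub>"
      using c by (auto simp: monomial_def zero_A fun_eq_iff)
    ultimately show "f \<in> zero_divisors A"
      using c f by (auto simp: zero_divisors_def intro!: bexI[of _ "monomial R c \<one>\<^bsub>M\<^esub>"])
  qed
qed (rule zero_divisors_A_subset)

section \<open>Domains, reduced rings and faithful ideals\<close>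

text \<open>Being a domain means that the zero ideal is prime, and the zero ideal of
  \<open>R\<close> extends to that of \<open>A\<close>.\<close>

lemma domain_A_iff: "domain A \<longleftrightarrow> domain R"
  using coeffs_in_prime_iff[of "{\<zero>}"]
  by (simp add: R.domain_eq_zeroprimeideal A.domain_eq_zeroprimeideal coeffs_in_zero)

text \<open>Contraction recovers \<open>I\<close> from its extension. Applied to the nilradical it
  transfers reducedness, and applied to an annihilator it transfers faithfulness.\<close>

lemma coeffs_in_eq_zero_iff:
  assumes "I \<subseteq> carrier R" "\<zero> \<in> I"
  shows "coeffs_in R M I = {\<zero>\<^bsub>A\<^esub>} \<longleftrightarrow> I = {\<zero>}"
  using contraction_coeffs_in[OF assms] contraction_coeffs_in[of "{\<zero>}"] coeffs_in_zero by auto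

lemma reduced_A_iff: "reduced_ring A \<longleftrightarrow> reduced_ring R"
proof -
  have *: "reduced_ring S \<longleftrightarrow> nilradical S = {\<zero>\<^bsub>S\<^esub>}" if "cring S" for S :: "('x, 'y) ring_scheme"
  proof -
    interpret cring S by fact
    have "\<zero>\<^bsub>S\<^esub> [^]\<^bsub>S\<^esub> (1::nat) = \<zero>\<^bsub>S\<^esub>" by simp
    then have "nilpotent S \<zero>\<^bsub>S\<^esub>" unfolding nilpotent_def using zero_closed zero_less_one by blast
    then show ?thesis by (auto simp: reduced_ring_def nilradical_def)
  qed
  have "nilradical R \<subseteq> carrier R" "\<zero> \<in> nilradical R"
    by (auto simp: nilradical_def nilpotent_def intro: exI[of _ "1::nat"])
  then show ?thesis
    by (simp add: *[OF cring_A] *[OF R.is_cring] nilradical_A coeffs_in_eq_zero_iff)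
qed

text \<open>Testing \<open>f\<close> against the constants from \<open>I\<close> shows that each
  coefficient of \<open>f\<close> kills \<open>I\<close>. In the other direction every term in the
  coefficient sums of the product vanishes.\<close>

lemma annihilator_coeffs_in:
  assumes I: "ideal I R"
  shows "annihilator A (coeffs_in R M I) = coeffs_in R M (annihilator R I)"
proof (intro equalityI subsetI)
  interpret I: ideal I R by fact
  fix f assume "f \<in> annihilator A (coeffs_in R M I)"
  then have f: "f \<in> carrier A" "\<And>g. g \<in> coeffs_in R M I \<Longrightarrow> f \<otimes>\<^bsub>A\<^esub> g = \<zero>\<^bsub>A\<^esub>"
    by (auto simp: annihilator_def)
  have "f m \<otimes> a = \<zero>" if a: "a \<in> I" for m a
  proof -
    have ac: "a \<in> carrier R" using a I.a_subset by blast
    have "monomial R a \<one>\<^bsub>M\<^esub> \<in> coeffs_in R M I"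
      using a ac I.a_subset I.zero_closed by (simp add: monomial_in_coeffs_in_iff)
    then have "monomial R a \<one>\<^bsub>M\<^esub> \<otimes>\<^bsub>A\<^esub> f = \<zero>\<^bsub>A\<^esub>"
      using f ac by (simp add: A.m_comm[of "monomial R a \<one>\<^bsub>M\<^esub>"])
    then have "a \<otimes> f m = \<zero>"
      using constant_mult_coeff[OF ac f(1), of m] by (simp add: zero_A)
    then show ?thesis using ac f by (simp add: R.m_comm)
  qed
  then show "f \<in> coeffs_in R M (annihilator R I)"
    using f by (simp add: coeffs_in_iff annihilator_def)
next
  interpret I: ideal I R by fact
  fix f assume f: "f \<in> coeffs_in R M (annihilator R I)"
  have zero: "\<zero> \<in> annihilator R I" using I.a_subset by (auto simp: annihilator_def)
  then have fc: "f \<in> carrier A" and fa: "\<And>m a. a \<in> I \<Longrightarrow> f m \<otimes> a = \<zero>"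
    using f by (auto simp: coeffs_in_iff' annihilator_def)
  have "f \<otimes>\<^bsub>A\<^esub> g = \<zero>\<^bsub>A\<^esub>" if g: "g \<in> coeffs_in R M I" for g
  proof
    fix m
    have gc: "g \<in> carrier A" and gI: "\<And>m. g m \<in> I" using g I.zero_closed by (auto simp: coeffs_in_iff')
    have fin: "finite (supp f)" "finite (supp g)" using fc gc by (auto simp: mem_A_iff)
    show "(f \<otimes>\<^bsub>A\<^esub> g) m = \<zero>\<^bsub>A\<^esub> m"
      unfolding mult_A_eq_sum[OF fc gc fin(1) order_refl fin(2) order_refl]
      by (simp add: fa gI zero_A)
  qed
  then show "f \<in> annihilator A (coeffs_in R M I)" using fc by (simp add: annihilator_def)
qed

lemma faithful_coeffs_in_iff:
  assumes I: "ideal I R"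
  shows "faithful_ideal A (coeffs_in R M I) \<longleftrightarrow> faithful_ideal R I"
proof -
  interpret I: ideal I R by fact
  have "annihilator R I \<subseteq> carrier R" "\<zero> \<in> annihilator R I"
    using I.a_subset by (auto simp: annihilator_def)
  then show ?thesis
    using I coeffs_in_ideal[OF I]
    by (simp add: faithful_ideal_def annihilator_coeffs_in coeffs_in_eq_zero_iff)
qed

end

theorem theorem7p12:
  fixes R :: "('a, 'b) ring_scheme"
    and M :: "('m, 'c) monoid_scheme"
    and lt :: "('m \<times> 'm) set"
  assumes "cring R"
    and "totally_ordered_monoid M lt"
    and "comm_monoid_cancel M"
  shows
    "(\<forall>P. P \<subseteq> carrier R \<and> P \<noteq> {} \<longrightarrow>
        (primeideal P R \<longleftrightarrow> primeideal (coeffs_in R M P) (monoid_ring R M))) \<and>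
     (domain R \<longleftrightarrow> domain (monoid_ring R M)) \<and>
     {Q. minimal_prime (monoid_ring R M) Q} = {coeffs_in R M P | P. minimal_prime R P} \<and>
     nilradical (monoid_ring R M) = coeffs_in R M (nilradical R) \<and>
     (reduced_ring R \<longleftrightarrow> reduced_ring (monoid_ring R M)) \<and>
     zero_divisors (monoid_ring R M) \<subseteq> (\<Union>P \<in> prime_spec R. coeffs_in R M P) \<and>
     (krull_dim R = 0 \<longrightarrow>
        zero_divisors (monoid_ring R M) = (\<Union>P \<in> prime_spec R. coeffs_in R M P)) \<and>
     (\<forall>f \<in> carrier (monoid_ring R M). \<forall>g \<in> carrier (monoid_ring R M).
        nilpotent (monoid_ring R M) (f \<otimes>\<^bsub>monoid_ring R M\<^esub> g) \<longleftrightarrow>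
        (\<forall>x \<in> carrier M. \<forall>y \<in> carrier M. nilpotent R (f x \<otimes>\<^bsub>R\<^esub> g y))) \<and>
     (\<forall>I. ideal I R \<longrightarrow>
        (faithful_ideal R I \<longleftrightarrow> faithful_ideal (monoid_ring R M) (coeffs_in R M I)))"
proof -
  interpret ordered_monoid_ring R M lt
    using assms by (intro ordered_monoid_ring.intro comm_monoid_ring.intro totally_ordered_monoid.axioms(1))
  show ?thesis
    by (intro conjI allI impI ballI)
      (simp_all only: coeffs_in_prime_iff domain_A_iff minimal_primes nilradical_A reduced_A_iff
        zero_divisors_A_subset zero_divisors_A_if_krull_dim_0 nilpotent_mult_A_iff
        faithful_coeffs_in_iff)
qed

end
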